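(* Let $m\ge 1$, let $S=\{R_k : k=0,\dots,m-1\}$ be the group of planar rotations $R_k$ by angle $2\pi k/m$, so $|S|=m$, and let $\delta>0$. Let $F$ be the feature map obtained by discretizing a continuous function $e:\mathbb{R}^2\times S\to\mathbb{R}$ with mesh size $\delta$. Suppose there is $G\ge 0$ such that for every $R\in S$ and $x\in\mathbb{R}^2$, $$\|\nabla_x e(x,R)\|\le G.$$ Then for every $\tilde R\in S$, every $x\in\mathbb{R}^2$ and every $R\in S$, $$\left|\Phi_{\mathrm{MP}}\left(\pi^F_{\tilde R}(F)\right)(x,R)-\left[\pi^F_{\tilde R}(\Phi_{\mathrm{MP}}(F))\right](x,R)\right|\le 2\sqrt{2}\,G\,\delta .$$
   Context: Discretization: the feature map $F$ obtained from $e$ with mesh size $\delta$ has entries $F^R_{ij}=e((i\delta,j\delta),R)$ for $i,j\in\mathbb{Z}$, $R\in S$; $e(\cdot,R)$ is assumed differentiable for each $R$. Rotation action: for a function $f:\mathbb{R}^2\times S\to\mathbb{R}$ and $\tilde R\in S$, $[\pi^F_{\tilde R}(f)](x,R)=f(\tilde R^{-1}x,\tilde R^{-1}R)$. For the feature map $F$ discretized from $e$, $\pi^F_{\tilde R}(F)$ is the feature map discretized from $\pi^F_{\tilde R}(e)$, i.e. $(\pi^F_{\tilde R}(F))^R_{ij}=e(\tilde R^{-1}(i\delta,j\delta),\tilde R^{-1}R)$. Max pooling: for a feature map $F$, $\Phi_{\mathrm{MP}}(F)$ is the function on $\mathbb{R}^2\times S$ given by $$[\Phi_{\mathrm{MP}}(F)](x,R)=\max_{(\hat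 i,\hat j)\in\Omega_x}F^R_{\hat i\hat j},\qquad \Omega_x=\{(i,j),(i+1,j),(i,j+1),(i+1,j+1)\},$$ where $x=(x_1,x_2)$, $i=\lfloor x_1/\delta\rfloor$, $j=\lfloor x_2/\delta\rfloor$. Norms on $\mathbb{R}^2$ are Euclidean. *)

theory Defs
  imports "HOL-Analysis.Analysis"
begin

type_synonym plane = "real ^ 2"
type_synonym rot = "real ^ 2 ^ 2"

definition planar_rotation :: "real \<Rightarrow> rot" where
  "planar_rotation \<theta> = vector [vector [cos \<theta>, - sin \<theta>], vector [sin \<theta>, cos \<theta>]]"

definition rotation_group :: "nat \<Rightarrow> rot set" where
  "rotation_group m = (\<lambda>k. planar_rotation (2 * pi * real k / real m)) ` {0..<m}"

(* Functions on R^2 x S are total functions of a point and a matrix; only their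
   values at matrices in S are ever constrained or used. *)

(* Meaningful where f is differentiable; see grad_eqI. *)
definition grad :: "(plane \<Rightarrow> real) \<Rightarrow> plane \<Rightarrow> plane" where
  "grad f x = (THE D. GDERIV f x :> D)"

lemma grad_eqI:
  assumes "GDERIV f x :> D"
  shows "grad f x = D"
  unfolding grad_def
proof (rule the_equality)
  show "GDERIV f x :> D" by (rule assms)
next
  fix D' assume "GDERIV f x :> D'"
  then have "(\<lambda>h. h \<bullet> D') = (\<lambda>h. h \<bullet> D)"
    using assms unfolding gderiv_def by (rule has_derivative_unique)
  then have "h \<bullet> D' = h \<bullet> D" for h by (rule fun_cong)
  then show "D' = D" by (metis vector_eq_rdot inner_commute)
qed

definition grid_point :: "real \<Rightarrow> int \<Rightarrow> int \<Rightarrow> plane" where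
  "grid_point \<delta> i j = vector [of_int i * \<delta>, of_int j * \<delta>]"

type_synonym feature_map = "int \<Rightarrow> int \<Rightarrow> rot \<Rightarrow> real"

definition discretize :: "real \<Rightarrow> (plane \<Rightarrow> rot \<Rightarrow> real) \<Rightarrow> feature_map" where
  "discretize \<delta> e = (\<lambda>i j R. e (grid_point \<delta> i j) R)"

definition rotate_fun :: "rot \<Rightarrow> (plane \<Rightarrow> rot \<Rightarrow> real) \<Rightarrow> (plane \<Rightarrow> rot \<Rightarrow> real)" where
  "rotate_fun Q f = (\<lambda>x R. f (matrix_inv Q *v x) (matrix_inv Q ** R))"

(* The rotated feature map depends on the underlying function e and not only on
   its discretization: rotated grid points need not be grid points. *)
definition rotate_feature_map :: "real \<Rightarrow> rot \<Rightarrow> (plane \<Rightarrow> rot \<Rightarrow> real) \<Rightarrow> feature_map" where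
  "rotate_feature_map \<delta> Q e = discretize \<delta> (rotate_fun Q e)"

definition pool_window :: "real \<Rightarrow> plane \<Rightarrow> (int \<times> int) set" where
  "pool_window \<delta> x =
    (let i = \<lfloor>x $ 1 / \<delta>\<rfloor>; j = \<lfloor>x $ 2 / \<delta>\<rfloor>
     in {(i, j), (i + 1, j), (i, j + 1), (i + 1, j + 1)})"

definition max_pool :: "real \<Rightarrow> feature_map \<Rightarrow> (plane \<Rightarrow> rot \<Rightarrow> real)" where
  "max_pool \<delta> F = (\<lambda>x R. Max ((\<lambda>(i, j). F i j R) ` pool_window \<delta> x))"

end

theory Submission
  imports Defs
begin

text \<open>
  Every point of a pooling window lies within \<open>sqrt 2 * \<delta>\<close> of the base point, so pooling the
  discretization of a \<open>G\<close>-Lipschitz function changes its value by at most \<open>sqrt 2 * G * \<delta>\<close>. Rotations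
  are isometries that permute \<open>S\<close>, so both pooled values are this close to the same number
  \<open>e (Q\<^sup>-\<^sup>1 x) (Q\<^sup>-\<^sup>1 R)\<close>.
\<close>

lemma planar_rotation_mult:
  "planar_rotation a ** planar_rotation b = planar_rotation (a + b)"
  unfolding planar_rotation_def
  by (simp add: vec_eq_iff forall_2 matrix_matrix_mult_def sum_2 cos_add sin_add)

lemma planar_rotation_0: "planar_rotation 0 = mat 1"
  unfolding planar_rotation_def by (simp add: vec_eq_iff forall_2 mat_def)

text \<open>\<open>matrix_inv\<close> is a choice among two-sided inverses; these are unique, since
  \<open>C = C ** (A ** B) = B\<close>.\<close>

lemma matrix_inv_eqI:
  fixes A B :: "real ^ 'n ^ 'n"
  assumes "A ** B = mat 1" "B ** A = mat 1"
  shows "matrix_inv A = B"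
  unfolding matrix_inv_def
proof (rule some_equality)
  fix C :: "real ^ 'n ^ 'n"
  assume "A ** C = mat 1 \<and> C ** A = mat 1"
  then show "C = B"
    using assms by (metis matrix_mul_assoc matrix_mul_lid matrix_mul_rid)
qed (use assms in simp)

lemma matrix_inv_planar_rotation: "matrix_inv (planar_rotation a) = planar_rotation (- a)"
  by (rule matrix_inv_eqI) (simp_all add: planar_rotation_mult planar_rotation_0)

lemma planar_rotation_periodic: "planar_rotation (a + 2 * pi) = planar_rotation a"
  unfolding planar_rotation_def by simp

lemma norm_planar_rotation: "norm (planar_rotation a *v x) = norm x"
proof -
  \<comment> \<open>The factor \<open>(sin a)\<^sup>2 + (cos a)\<^sup>2\<close> stays unevaluated so
    that the identity is purely polynomial; simplification turns it into 1 afterwards.\<close>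
  have "(cos a * x$1 - sin a * x$2)\<^sup>2 + (sin a * x$1 + cos a * x$2)\<^sup>2
      = ((sin a)\<^sup>2 + (cos a)\<^sup>2) * ((x$1)\<^sup>2 + (x$2)\<^sup>2)"
    by algebra
  then show ?thesis
    unfolding planar_rotation_def norm_vec_def L2_set_def
    by (simp add: sum_2 matrix_vector_mult_def)
qed

lemma norm_matrix_inv_rotation_group:
  assumes "Q \<in> rotation_group m"
  shows "norm (matrix_inv Q *v x) = norm x"
  using assms unfolding rotation_group_def
  by (auto simp: matrix_inv_planar_rotation norm_planar_rotation)

text \<open>Angles subtract modulo a full turn. This closure makes the gradient bound, assumed only
  on \<open>S\<close>, available at the rotated orientation.\<close>

lemma rotation_group_inv_mult:
  assumes "Q \<in> rotation_group m" "R \<in> rotation_group m"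
  shows "matrix_inv Q ** R \<in> rotation_group m"
proof -
  obtain k l where k: "k < m" "Q = planar_rotation (2 * pi * real k / real m)"
    and l: "l < m" "R = planar_rotation (2 * pi * real l / real m)"
    using assms unfolding rotation_group_def by auto
  define a where "a = 2 * pi * real l / real m - 2 * pi * real k / real m"
  have QR: "matrix_inv Q ** R = planar_rotation a"
    by (simp add: k l a_def matrix_inv_planar_rotation planar_rotation_mult)
  show ?thesis
  proof (cases "k \<le> l")
    case True
    then have "a = 2 * pi * real (l - k) / real m"
      by (simp add: a_def of_nat_diff right_diff_distrib diff_divide_distrib)
    with QR l show ?thesis unfolding rotation_group_def by auto
  next
    case False
    \<comment> \<open>Here \<open>l < k\<close> makes the angle negative. A full turn shifts the
      index to \<open>l + m - k\<close>, which is below \<open>m\<close> because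
      \<open>l < k\<close>; the subtraction does not truncate because \<open>k < m\<close>.\<close>
    then have "a + 2 * pi = 2 * pi * real (l + m - k) / real m"
      using k by (simp add: a_def of_nat_diff field_simps)
    with QR False k show ?thesis
      unfolding rotation_group_def
      by (intro image_eqI[where x = "l + m - k"]) (auto simp flip: planar_rotation_periodic[of a])
  qed
qed

text \<open>Riesz representation: a linear functional \<open>f'\<close> is the inner product with
  \<open>adjoint f' 1\<close>, so a gradient exists and the description in \<open>grad\<close>
  denotes it.\<close>

lemma gderiv_grad:
  assumes "f differentiable (at x)"
  shows "GDERIV f x :> grad f x"
proof -
  obtain f' where f': "(f has_derivative f') (at x)"
    using assms unfolding differentiable_def by blast
  then have "linear f'" by (rule has_derivative_linear)
  then have "f' h = h \<bullet> adjoint f' 1" for h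
    using adjoint_works[of f' h 1] by simp
  then have "f' = (\<lambda>h. h \<bullet> adjoint f' 1)" by (rule ext)
  with f' have "GDERIV f x :> adjoint f' 1" unfolding gderiv_def by simp
  then show ?thesis using grad_eqI by metis
qed

text \<open>Mean value inequality on the convex set \<open>UNIV\<close>; Cauchy-Schwarz bounds the
  operator norm of the derivative by the norm of the gradient.\<close>

lemma lipschitz_of_grad_bound:
  fixes f :: "plane \<Rightarrow> real"
  assumes "\<And>x. f differentiable (at x)" and "\<And>x. norm (grad f x) \<le> G"
  shows "\<bar>f y - f x\<bar> \<le> G * norm (y - x)"
proof -
  have "norm (f y - f x) \<le> G * norm (y - x)"
  proof (rule differentiable_bound[where S = UNIV and f' = "\<lambda>x h. h \<bullet> grad f x"])
    fix x :: plane
    show "(f has_derivative (\<lambda>h. h \<bullet> grad f x)) (at x within UNIV)"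
      using gderiv_grad[OF assms(1)] unfolding gderiv_def by simp
    have "norm (h \<bullet> grad f x) \<le> G * norm h" for h
      using Cauchy_Schwarz_ineq2[of h "grad f x"] mult_right_mono[OF assms(2)[of x], of "norm h"]
      by (simp add: mult.commute)
    then show "onorm (\<lambda>h. h \<bullet> grad f x) \<le> G" by (rule onorm_le)
  qed auto
  then show ?thesis by simp
qed

text \<open>In each coordinate the window uses the two multiples of \<open>\<delta>\<close> that
  enclose the coordinate of \<open>x\<close>, so both offsets are at most \<open>\<delta>\<close>;
  Pythagoras gives the factor \<open>sqrt 2\<close>.\<close>

lemma pool_window_dist:
  assumes "\<delta> > 0" "(i, j) \<in> pool_window \<delta> x"
  shows "norm (grid_point \<delta> i j - x) \<le> sqrt 2 * \<delta>"
proof -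
  have near: "(of_int n * \<delta> - t)\<^sup>2 \<le> \<delta>\<^sup>2" if "n = \<lfloor>t / \<delta>\<rfloor> \<or> n = \<lfloor>t / \<delta>\<rfloor> + 1" for n t
  proof -
    have "of_int \<lfloor>t / \<delta>\<rfloor> * \<delta> \<le> t" "t < (of_int \<lfloor>t / \<delta>\<rfloor> + 1) * \<delta>"
      using assms(1) by (simp_all flip: pos_le_divide_eq pos_divide_less_eq)
    with that have "\<bar>of_int n * \<delta> - t\<bar> \<le> \<delta>"
      by (auto simp: algebra_simps)
    then show ?thesis using assms(1) by (simp flip: abs_le_square_iff)
  qed
  have "(of_int i * \<delta> - x$1)\<^sup>2 + (of_int j * \<delta> - x$2)\<^sup>2 \<le> 2 * \<delta>\<^sup>2"
    using near[of i "x$1"] near[of j "x$2"] assms(2) unfolding pool_window_def Let_def by auto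
  then have "norm (grid_point \<delta> i j - x) \<le> sqrt (2 * \<delta>\<^sup>2)"
    unfolding grid_point_def norm_vec_def L2_set_def by (simp add: sum_2)
  also have "\<dots> = sqrt 2 * \<delta>"
    using assms(1) by (simp add: real_sqrt_mult)
  finally show ?thesis .
qed

text \<open>The maximum over the finite nonempty window is attained, so it inherits any bound shared
  by all entries.\<close>

lemma max_pool_near:
  assumes "\<And>i j. (i, j) \<in> pool_window \<delta> x \<Longrightarrow> \<bar>F i j R - c\<bar> \<le> b"
  shows "\<bar>max_pool \<delta> F x R - c\<bar> \<le> b"
proof -
  have "max_pool \<delta> F x R \<in> (\<lambda>(i, j). F i j R) ` pool_window \<delta> x"
    unfolding max_pool_def by (rule Max_in) (auto simp: pool_window_def Let_def)
  with assms show ?thesis by auto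
qed

theorem theorem3p1:
  fixes m :: nat and S :: "rot set" and \<delta> G :: real
    and e :: "plane \<Rightarrow> rot \<Rightarrow> real" and F :: feature_map
  assumes "m \<ge> 1"
    and "S = rotation_group m"
    and "\<delta> > 0"
    and "continuous_on (UNIV \<times> S) (\<lambda>(x, R). e x R)"
    and "\<forall>R\<in>S. \<forall>x. (\<lambda>y. e y R) differentiable (at x)"
    and "F = discretize \<delta> e"
    and "G \<ge> 0"
    and "\<forall>R\<in>S. \<forall>x. norm (grad (\<lambda>y. e y R) x) \<le> G"
  shows "\<forall>Q\<in>S. \<forall>x. \<forall>R\<in>S.
    \<bar>max_pool \<delta> (rotate_feature_map \<delta> Q e) x R - rotate_fun Q (max_pool \<delta> F) x R\<bar>
      \<le> 2 * sqrt 2 * G * \<delta>"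
proof (intro ballI allI)
  fix Q x R
  assume Q: "Q \<in> S" and R: "R \<in> S"
  define x' where "x' = matrix_inv Q *v x"
  define R' where "R' = matrix_inv Q ** R"
  have R': "R' \<in> S"
    using Q R rotation_group_inv_mult unfolding R'_def \<open>S = rotation_group m\<close> by blast
  have near: "\<bar>e y R' - e x' R'\<bar> \<le> sqrt 2 * G * \<delta>" if "norm (y - x') \<le> sqrt 2 * \<delta>" for y
  proof -
    have "\<bar>e y R' - e x' R'\<bar> \<le> G * norm (y - x')"
      using lipschitz_of_grad_bound[of "\<lambda>y. e y R'"] assms(5,8) R' by blast
    also have "\<dots> \<le> G * (sqrt 2 * \<delta>)"
      using that \<open>G \<ge> 0\<close> by (rule mult_left_mono)
    finally show ?thesis by (simp add: mult_ac)
  qed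
  have "\<bar>max_pool \<delta> (rotate_feature_map \<delta> Q e) x R - e x' R'\<bar> \<le> sqrt 2 * G * \<delta>"
  proof (rule max_pool_near)
    fix i j
    assume "(i, j) \<in> pool_window \<delta> x"
    \<comment> \<open>The window here surrounds \<open>x\<close>, not \<open>x'\<close>. Its points
      are carried near \<open>x'\<close> by the inverse rotation, which preserves their distance to
      the base point.\<close>
    then have "norm (matrix_inv Q *v (grid_point \<delta> i j - x)) \<le> sqrt 2 * \<delta>"
      using pool_window_dist Q \<open>S = rotation_group m\<close> \<open>\<delta> > 0\<close>
      by (simp add: norm_matrix_inv_rotation_group)
    then have "norm (matrix_inv Q *v grid_point \<delta> i j - x') \<le> sqrt 2 * \<delta>"
      by (simp add: x'_def matrix_vector_mult_diff_distrib)
    from near[OF this]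
    show "\<bar>rotate_feature_map \<delta> Q e i j R - e x' R'\<bar> \<le> sqrt 2 * G * \<delta>"
      by (simp add: rotate_feature_map_def discretize_def rotate_fun_def R'_def)
  qed
  \<comment> \<open>On this side pooling happens after the rotation of the argument, so the window
    surrounds \<open>x'\<close> itself and its grid points stay unrotated.\<close>
  moreover have "\<bar>max_pool \<delta> F x' R' - e x' R'\<bar> \<le> sqrt 2 * G * \<delta>"
  proof (rule max_pool_near)
    fix i j
    assume "(i, j) \<in> pool_window \<delta> x'"
    from near[OF pool_window_dist[OF \<open>\<delta> > 0\<close> this]]
    show "\<bar>F i j R' - e x' R'\<bar> \<le> sqrt 2 * G * \<delta>"
      by (simp add: \<open>F = discretize \<delta> e\<close> discretize_def)
  qed
  moreover have "rotate_fun Q (max_pool \<delta> F) x R = max_pool \<delta> F x' R'"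
    by (simp add: rotate_fun_def x'_def R'_def)
  ultimately show "\<bar>max_pool \<delta> (rotate_feature_map \<delta> Q e) x R
      - rotate_fun Q (max_pool \<delta> F) x R\<bar> \<le> 2 * sqrt 2 * G * \<delta>"
    by linarith
qed

end
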